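(* Let $F:H^1_{\mathbb C}\to H^1_{\mathbb C}$ be a quasiconformal map of the first complex Heisenberg group. Suppose $F$ is the lifting of a map $f:\mathbb C^2\to\mathbb C^2$ of the form $f(w_1,w_2)=(w_1,w_2+g(w_1))$, where $g:\mathbb C\to\mathbb C$ is a map. Then there are constants $a,b\in\mathbb C$ such that $g(w_1)=aw_1+b$ for all $w_1\in\mathbb C$.
   Context: The first complex Heisenberg algebra $\mathcal H^1_{\mathbb C}$ is the complex Lie algebra with complex basis $X,Y,Z$ and only nontrivial bracket relation $[X,Y]=Z$. It is graded with $V_1=\mathbb CX\oplus\mathbb CY$ and $V_2=\mathbb C Z$. $H^1_{\mathbb C}$ is the simply connected Lie group with Lie algebra $\mathcal H^1_{\mathbb C}$, equipped with a Carnot (sub-Riemannian) metric associated with $V_1$ (i.e. with the left invariant distribution determined by $V_1$ and a left invariant inner product on it). Both $H^1_{\mathbb C}$ and $\mathcal H^1_{\mathbb C}$ are identified with $\mathbb C^3$ via the exponential map and the basis $X,Y,Z$; a point is written $(w_1,w_2,z)$. Let $\pi_1:\mathbb C^3\to\mathbb C^2$, $\pi_1(w_1,w_2,z)=(w_1,w_2)$. A map $F:\mathbb C^3\to\mathbb C^3$ is called a lifting of $f:\mathbb C^2\to\mathbb C^2$ if $F(\pi_1^{-1}(p))=\pi_1^{-1}(f(p))$ for all $p\in\mathbb C^2$. A homeomorphism $F$ of a metric space $(X,d)$ is quasiconformal if there is $H<\infty$ with $\limsup_{r\to0}\frac{\sup\{d(F(x),F(y)):d(x,y)\le r\}}{\inf\{d(F(x),F(y)):d(x,y)\ge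 r\}}\le H$ for all $x\in X$. (For Carnot groups this is equivalent to being quasisymmetric.) *)

theory Defs
  imports "HOL-Analysis.Analysis"
begin

section \<open>Absolutely continuous curves\<close>

text \<open>The finite families of non-overlapping compact intervals in the usual epsilon-delta
  definition are the divisions \<open>D\<close> of subsets of \<open>S\<close>; an element \<open>K = {x..y}\<close> of \<open>D\<close> has
  \<open>Inf K = x\<close> and \<open>Sup K = y\<close>.\<close>

definition absolutely_continuous_on :: "real set \<Rightarrow> (real \<Rightarrow> 'a::real_normed_vector) \<Rightarrow> bool"
  where "absolutely_continuous_on S \<gamma> \<longleftrightarrow>
    (\<forall>\<epsilon>>0. \<exists>\<delta>>0. \<forall>D. D division_of \<Union>D \<and> \<Union>D \<subseteq> S \<and> (\<Sum>K\<in>D. measure lborel K) < \<delta> \<longrightarrow>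
       (\<Sum>K\<in>D. dist (\<gamma> (Inf K)) (\<gamma> (Sup K))) < \<epsilon>)"


section \<open>The first complex Heisenberg group\<close>

type_synonym heis = "complex \<times> complex \<times> complex"

text \<open>\<open>(w\<^sub>1, w\<^sub>2, z)\<close> stands for \<open>w\<^sub>1 X + w\<^sub>2 Y + z Z\<close>. The bracket is the complex bilinear one with
  \<open>[X, Y] = Z\<close> and \<open>Z\<close> central.\<close>

fun heis_bracket :: "heis \<Rightarrow> heis \<Rightarrow> heis"
  where "heis_bracket (w1, w2, z) (w1', w2', z') = (0, 0, w1 * w2' - w2 * w1')"

text \<open>The group law in exponential coordinates, by the Baker-Campbell-Hausdorff formula for a
  Lie algebra of step two. The neutral element is \<open>0\<close>.\<close>

definition heis_mult :: "heis \<Rightarrow> heis \<Rightarrow> heis"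
  where "heis_mult p q = p + q + (1/2) *\<^sub>R heis_bracket p q"

text \<open>The differential at \<open>0\<close> of the left translation by \<open>p\<close>.\<close>

definition left_transl_diff :: "heis \<Rightarrow> heis \<Rightarrow> heis"
  where "left_transl_diff p v = v + (1/2) *\<^sub>R heis_bracket p v"

lemma heis_mult_assoc: "heis_mult (heis_mult p q) r = heis_mult p (heis_mult q r)"
  by (cases p; cases q; cases r)
     (simp add: heis_mult_def scaleR_conv_of_real algebra_simps)

lemma heis_mult_zero: "heis_mult 0 p = p" "heis_mult p 0 = p"
  by (cases p; simp add: heis_mult_def zero_prod_def)+

lemma heis_mult_uminus: "heis_mult (- p) p = 0" "heis_mult p (- p) = 0"
  by (cases p; simp add: heis_mult_def zero_prod_def)+

lemma has_derivative_heis_mult: "(heis_mult p has_derivative left_transl_diff p) (at 0)"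
proof -
  obtain w1 w2 z where p: "p = (w1, w2, z)"
    by (cases p)
  have b: "heis_bracket p = (\<lambda>q. (0, 0, w1 * fst (snd q) - w2 * fst q))"
    by (auto simp: p)
  show ?thesis
    unfolding heis_mult_def left_transl_diff_def b
    by (auto intro!: derivative_eq_intros)
qed

definition pi1 :: "heis \<Rightarrow> complex \<times> complex"
  where "pi1 = (\<lambda>(w1, w2, z). (w1, w2))"

text \<open>The inclusion of the first layer \<open>V\<^sub>1 = \<complex>X \<oplus> \<complex>Y\<close>, with \<open>V\<^sub>1\<close> identified with \<open>\<complex>\<^sup>2\<close>.\<close>

definition V1_incl :: "complex \<times> complex \<Rightarrow> heis"
  where "V1_incl = (\<lambda>(u1, u2). (u1, u2, 0))"


section \<open>The Carnot metric\<close>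

definition is_inner_product :: "('a::real_vector \<Rightarrow> 'a \<Rightarrow> real) \<Rightarrow> bool"
  where "is_inner_product B \<longleftrightarrow>
    bilinear B \<and> (\<forall>u v. B u v = B v u) \<and> (\<forall>u. u \<noteq> 0 \<longrightarrow> B u u > 0)"

text \<open>\<open>\<gamma>\<close> is a horizontal curve whose velocity at almost every time \<open>t\<close> is the value at \<open>\<gamma> t\<close> of the
  left invariant vector field determined by \<open>u t \<in> V\<^sub>1\<close>. This determines \<open>u\<close> almost everywhere.\<close>

definition horizontal_curve ::
    "(real \<Rightarrow> heis) \<Rightarrow> (real \<Rightarrow> complex \<times> complex) \<Rightarrow> bool"
  where "horizontal_curve \<gamma> u \<longleftrightarrow>
    absolutely_continuous_on {0..1} \<gamma> \<and>
    (AE t in lebesgue_on {0..1}.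
       (\<gamma> has_vector_derivative left_transl_diff (\<gamma> t) (V1_incl (u t))) (at t within {0..1}))"

text \<open>The infimum of the lengths of the horizontal curves from \<open>p\<close> to \<open>q\<close>, for the left invariant
  inner product on the horizontal distribution that extends the inner product \<open>B\<close> on \<open>V\<^sub>1\<close>.\<close>

definition carnot_dist ::
    "(complex \<times> complex \<Rightarrow> complex \<times> complex \<Rightarrow> real) \<Rightarrow> heis \<Rightarrow> heis \<Rightarrow> real"
  where "carnot_dist B p q = Inf {L. \<exists>\<gamma> u. horizontal_curve \<gamma> u \<and> \<gamma> 0 = p \<and> \<gamma> 1 = q \<and>
      ((\<lambda>t. sqrt (B (u t) (u t))) has_integral L) {0..1}}"


section \<open>Quasiconformal maps and liftings\<close>

text \<open>Suprema, infima and the quotient are taken in \<^typ>\<open>ereal\<close>, so that an unbounded set has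
  supremum \<open>\<infinity>\<close> and a quotient with positive numerator and denominator \<open>0\<close> is \<open>\<infinity>\<close>.\<close>

definition quasiconformal :: "'a set \<Rightarrow> ('a \<Rightarrow> 'a \<Rightarrow> real) \<Rightarrow> ('a \<Rightarrow> 'a) \<Rightarrow> bool"
  where "quasiconformal X d F \<longleftrightarrow>
    homeomorphic_map (Metric_space.mtopology X d) (Metric_space.mtopology X d) F \<and>
    (\<exists>H::real. \<forall>x\<in>X.
       Limsup (at_right 0) (\<lambda>r.
         (SUP y\<in>{y\<in>X. d x y \<le> r}. ereal (d (F x) (F y))) /
         (INF y\<in>{y\<in>X. d x y \<ge> r}. ereal (d (F x) (F y)))) \<le> ereal H)"

definition is_lifting :: "(heis \<Rightarrow> heis) \<Rightarrow> (complex \<times> complex \<Rightarrow> complex \<times> complex) \<Rightarrow> bool"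
  where "is_lifting F f \<longleftrightarrow> (\<forall>p. F ` (pi1 -` {p}) = pi1 -` {f p})"

end

theory Submission
  imports Defs "HOL-Complex_Analysis.Cauchy_Integral_Formula"
begin

text \<open>Moving by \<open>(0, u\<^sub>2)\<close> in the base commutes with \<open>f\<close>, and \<open>F\<close> maps fibres of \<open>\<pi>\<^sub>1\<close> onto fibres. The points
  of the fibre over \<open>\<pi>\<^sub>1 x + (0, u\<^sub>2)\<close> are at distance at least a multiple of \<open>\<bar>u\<^sub>2\<bar>\<close> from \<open>x\<close>, while some
  point of the image fibre is at distance at most a multiple of \<open>\<bar>u\<^sub>2\<bar>\<close> from \<open>F x\<close>. This bounds the infimum
  in the definition of quasiconformality by a multiple of \<open>r\<close>, so \<open>F\<close> is infinitesimally Lipschitz with a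
  uniform constant. Writing \<open>F (w, 0, 0) = (w, g w, Z w)\<close>, the estimate of the third coordinate of
  \<open>p\<^sup>-\<^sup>1 q\<close> by the square of the distance makes \<open>w g w - 2 Z w\<close> complex differentiable with derivative \<open>2 g\<close>.
  Hence \<open>g\<close> is entire with bounded derivative, and Liouville's theorem applies.\<close>

section \<open>Absolutely continuous functions\<close>

text \<open>Members of a division overlap only in null sets, so their contents add up to the measure
  of the union. This supplies the smallness condition in \<open>absolutely_continuous_on\<close>
  from an enclosing set of small measure.\<close>

lemma content_division_le:
  fixes D :: "'a::euclidean_space set set"
  assumes D: "D division_of \<Union>D" and U: "\<Union>D \<subseteq> U" "U \<in> lmeasurable"
  shows "(\<Sum>K\<in>D. measure lborel K) \<le> measure lebesgue U"
proof -
  have "measure lborel K = measure lebesgue K" if "K \<in> D" for K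
    using division_ofD(4)[OF D that] by auto
  then have "(\<Sum>K\<in>D. measure lborel K) = measure lebesgue (\<Union>D)"
    using content_division[OF D] by simp
  also have "\<dots> \<le> measure lebesgue U"
    by (rule measure_mono_fmeasurable[OF U(1) fmeasurableD[OF lmeasurable_division[OF D]] U(2)])
  finally show ?thesis .
qed

text \<open>Absolute continuity speaks of sets of intervals, Riemann sums of tagged ones. Two
  different tags can share an interval only if its interior is empty; it is then a single point,
  where \<open>h\<close> vanishes.\<close>

lemma sum_tagged_partial_division:
  fixes p :: "(real \<times> real set) set" and h :: "real set \<Rightarrow> real"
  assumes p: "p tagged_partial_division_of I" and h: "\<And>a. h {a..a} = 0"
  shows "(\<Sum>(x,K)\<in>p. h K) = (\<Sum>K\<in>snd ` p. h K)"
proof -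
  have "(\<Sum>(x,K)\<in>p. h K) = (\<Sum>z\<in>p. h (snd z))" by (simp add: case_prod_beta)
  also have "\<dots> = (\<Sum>K\<in>snd ` p. h K)"
  proof (rule sum.reindex_nontrivial[symmetric, unfolded o_def])
    show "finite p" using p by (rule tagged_partial_division_ofD(1))
    fix y z assume yz: "y \<in> p" "z \<in> p" "y \<noteq> z" "snd y = snd z"
    obtain x1 x2 K where e: "y = (x1,K)" "z = (x2,K)" using yz(4) by (metis prod.collapse)
    then have "interior K \<inter> interior K = {}" 
      using tagged_partial_division_ofD(5)[OF p, of x1 K x2 K] yz by auto
    moreover obtain a b where "K = cbox a b" "x1 \<in> K"
      using tagged_partial_division_ofD(2,4)[OF p] yz(1) e(1) by metis
    ultimately have "K = {a..a}" by auto
    then show "h (snd y) = 0" using h e by simp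
  qed
  finally show ?thesis .
qed

text \<open>On the tags in \<open>N\<close> the gauge confines the intervals to an open set \<open>U\<close> of small measure, where absolute
  continuity controls the increments of \<open>f\<close>; on the other tags it comes from the derivative.\<close>

lemma fundamental_theorem_of_calculus_absolutely_continuous:
  fixes f :: "real \<Rightarrow> 'a::banach"
  assumes "a \<le> b" and AC: "absolutely_continuous_on {a..b} f" and N: "negligible N"
    and der: "\<And>x. x \<in> {a..b} - N \<Longrightarrow> (f has_vector_derivative f' x) (at x within {a..b})"
  shows "(f' has_integral (f b - f a)) {a..b}"
proof -
  \<comment> \<open>With the value 0 on \<open>N\<close>, a tag in \<open>N\<close> contributes
    nothing to the Riemann sum, only an increment of \<open>f\<close>.\<close>
  define h where "h x = (if x \<in> N then 0 else f' x)" for x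
  have "(h has_integral (f b - f a)) {a..b}"
    unfolding has_integral_real
  proof safe
    fix e :: real assume "e > 0"
    obtain \<delta> where \<delta>: "\<delta> > 0" and
      AC': "\<And>D. \<lbrakk>D division_of \<Union>D; \<Union>D \<subseteq> {a..b}; (\<Sum>K\<in>D. measure lborel K) < \<delta>\<rbrakk> \<Longrightarrow>
        (\<Sum>K\<in>D. dist (f (Inf K)) (f (Sup K))) < e/2"
      using AC[unfolded absolutely_continuous_on_def, rule_format, of "e/2"] \<open>e > 0\<close> by auto
    have Ns: "N \<in> sets lebesgue" "emeasure lebesgue N = 0"
      using N negligible_iff_null_sets by auto
    obtain U where U: "open U" "N \<subseteq> U" "U - N \<in> lmeasurable" "emeasure lebesgue (U - N) < ennreal \<delta>"
      using sets_lebesgue_outer_open[OF Ns(1) \<delta>] by blast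
    have UN: "U = (U - N) \<union> N" using U(2) by blast
    have mU: "U \<in> lmeasurable"
      by (subst UN) (rule fmeasurable.Un[OF U(3) negligible_imp_measurable[OF N]])
    have "measure lebesgue U = measure lebesgue (U - N)"
      by (subst UN, rule measure_Un_null_set[OF fmeasurableD[OF U(3)]])
         (use N negligible_iff_null_sets in blast)
    then have mU\<delta>: "measure lebesgue U < \<delta>"
      using U(3,4) \<delta> by (simp add: emeasure_eq_measure2 ennreal_less_iff)
    \<comment> \<open>The summand 1 keeps the denominator positive when
      \<open>a = b\<close>.\<close>
    define \<epsilon> where "\<epsilon> = e / (2 * (b - a + 1))"
    have \<epsilon>: "\<epsilon> > 0" "\<epsilon> * (b - a) \<le> e/2"
      using \<open>e > 0\<close> \<open>a \<le> b\<close> by (auto simp: \<epsilon>_def field_simps)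
    have "\<exists>d>0. (x \<in> N \<longrightarrow> ball x d \<subseteq> U) \<and> (x \<in> {a..b} - N \<longrightarrow>
        (\<forall>y\<in>{a..b}. norm (y-x) < d \<longrightarrow> norm (f y - f x - (y-x) *\<^sub>R f' x) \<le> \<epsilon> * norm (y-x)))" for x
    proof (cases "x \<in> N")
      case True
      then obtain d where "d > 0" "ball x d \<subseteq> U" using U(1,2) openE by blast
      then show ?thesis using True by blast
    next
      case False
      show ?thesis
      proof (cases "x \<in> {a..b}")
        case True
        with False show ?thesis
          using der[of x, unfolded has_vector_derivative_def has_derivative_within_alt] \<epsilon>(1) by blast
      qed (use False in \<open>auto intro: exI[of _ 1]\<close>)
    qed
    then obtain d where d: "\<And>x. 0 < d x" "\<And>x. x \<in> N \<Longrightarrow> ball x (d x) \<subseteq> U"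
      "\<And>x y. \<lbrakk>x \<in> {a..b} - N; y \<in> {a..b}; norm (y-x) < d x\<rbrakk>
        \<Longrightarrow> norm (f y - f x - (y-x) *\<^sub>R f' x) \<le> \<epsilon> * norm (y-x)"
      by metis
    show "\<exists>\<gamma>. gauge \<gamma> \<and> (\<forall>\<D>. \<D> tagged_division_of {a..b} \<and> \<gamma> fine \<D> \<longrightarrow>
        norm ((\<Sum>(x,k)\<in>\<D>. measure lborel k *\<^sub>R h x) - (f b - f a)) < e)"
    proof (intro exI conjI allI impI; (elim conjE)?)
      show "gauge (\<lambda>x. ball x (d x))" using d(1) by (simp add: gauge_ball_dependent)
    next
      fix p assume p: "p tagged_division_of {a..b}" and fine: "(\<lambda>x. ball x (d x)) fine p"
      define g where "g = (\<lambda>(x,K). measure lborel K *\<^sub>R h x - (f (Sup K) - f (Inf K)))"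
      have fin: "finite p" using tagged_division_ofD(1)[OF p] .
      define q where "q = {z\<in>p. fst z \<in> N}"
      have qp: "q \<subseteq> p" "finite q" using fin by (auto simp: q_def)
      have qpart: "q tagged_partial_division_of {a..b}"
        using tagged_partial_division_subset[OF _ qp(1)] p by (simp add: tagged_division_of_def)
      have Kab: "\<exists>u v. K = {u..v} \<and> u \<le> x \<and> x \<le> v \<and> a \<le> u \<and> v \<le> b" if xKp: "(x,K) \<in> p" for x K
      proof -
        obtain u v where "K = cbox u v" "x \<in> K" "K \<subseteq> {a..b}"
          using tagged_division_ofD(2,3,4)[OF p xKp] by metis
        then show ?thesis by auto
      qed
      have 1: "(\<Sum>z\<in>q. norm (g z)) < e/2"
      proof -
        have "(\<Sum>z\<in>q. norm (g z)) = (\<Sum>(x,K)\<in>q. dist (f (Inf K)) (f (Sup K)))"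
          by (intro sum.cong refl) (auto simp: q_def g_def h_def dist_norm)
        also have "\<dots> = (\<Sum>K\<in>snd ` q. dist (f (Inf K)) (f (Sup K)))"
          by (rule sum_tagged_partial_division[OF qpart]) simp
        also have "\<dots> < e/2"
        proof (rule AC')
          show dv: "snd ` q division_of \<Union>(snd ` q)"
            by (rule partial_division_of_tagged_division[OF qpart])
          show "\<Union>(snd ` q) \<subseteq> {a..b}"
            using tagged_partial_division_ofD(3)[OF qpart] by force
          have "\<Union>(snd ` q) \<subseteq> U"
          proof clarsimp
            fix y x K assume "(x,K) \<in> q" "y \<in> K"
            then have "x \<in> N" "(x,K) \<in> p" by (auto simp: q_def)
            then have "y \<in> ball x (d x)" using fine \<open>y \<in> K\<close> unfolding fine_def by blast
            then show "y \<in> U" using d(2) \<open>x \<in> N\<close> by blast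
          qed
          then show "(\<Sum>K\<in>snd ` q. measure lborel K) < \<delta>"
            using content_division_le[OF dv _ mU] mU\<delta> by linarith
        qed
        finally show ?thesis .
      qed
      have 2: "(\<Sum>z\<in>p-q. norm (g z)) \<le> e/2"
      proof -
        have "(\<Sum>z\<in>p-q. norm (g z)) \<le> (\<Sum>z\<in>p-q. \<epsilon> * (Sup (snd z) - Inf (snd z)))"
        proof (rule sum_mono)
          fix z assume z: "z \<in> p - q"
          obtain x K where xK: "z = (x,K)" by fastforce
          then have xN: "x \<notin> N" "(x,K) \<in> p" using z by (auto simp: q_def)
          obtain u v where K: "K = {u..v}" "u \<le> x" "x \<le> v" "a \<le> u" "v \<le> b" using Kab[OF xN(2)] by blast
          have KB: "K \<subseteq> ball x (d x)" using fine xN(2) by (auto simp: fine_def)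
          have "u \<in> ball x (d x)" "v \<in> ball x (d x)" using subsetD[OF KB] K by simp_all
          then have uv: "norm (u - x) < d x" "norm (v - x) < d x" by (simp_all add: dist_real_def abs_minus_commute)
          \<comment> \<open>The tag \<open>x\<close> lies between \<open>u\<close> and
            \<open>v\<close>, so both increments are compared with the derivative at
            \<open>x\<close>, and the two errors add up to a multiple of
            \<open>v - u\<close>.\<close>
          have "norm ((v - u) *\<^sub>R f' x - (f v - f u)) = norm (f u - f x - (u - x) *\<^sub>R f' x - (f v - f x - (v - x) *\<^sub>R f' x))"
            by (auto simp: algebra_simps)
          also have "\<dots> \<le> norm (f u - f x - (u - x) *\<^sub>R f' x) + norm (f v - f x - (v - x) *\<^sub>R f' x)"
            by (rule norm_triangle_ineq4)
          also have "\<dots> \<le> \<epsilon> * norm (u - x) + \<epsilon> * norm (v - x)"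
            by (intro add_mono d(3)) (use K xN uv in auto)
          also have "\<dots> = \<epsilon> * (v - u)" using K by (simp add: algebra_simps)
          finally show "norm (g z) \<le> \<epsilon> * (Sup (snd z) - Inf (snd z))"
            using K xK xN by (simp add: g_def h_def)
        qed
        also have "\<dots> \<le> (\<Sum>z\<in>p. \<epsilon> * (Sup (snd z) - Inf (snd z)))"
        proof (rule sum_mono2[OF fin Diff_subset])
          fix z assume "z \<in> p - (p - q)"
          then obtain u v where "snd z = {u..v}" "u \<le> v" using Kab[of "fst z" "snd z"] by force
          then show "0 \<le> \<epsilon> * (Sup (snd z) - Inf (snd z))" using \<epsilon>(1) by simp
        qed
        also have "\<dots> = \<epsilon> * (\<Sum>(x,K)\<in>p. Sup K - Inf K)"
          by (simp add: sum_distrib_left case_prod_beta)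
        also have "\<dots> = \<epsilon> * (b - a)"
          using additive_tagged_division_1[OF \<open>a \<le> b\<close> p, of "\<lambda>x. x"] by simp
        finally show ?thesis using \<epsilon>(2) by simp
      qed
      have "f b - f a = (\<Sum>z\<in>p. f (Sup (snd z)) - f (Inf (snd z)))"
        using additive_tagged_division_1[OF \<open>a \<le> b\<close> p, of f] by (simp add: case_prod_beta)
      then have "(\<Sum>(x,k)\<in>p. measure lborel k *\<^sub>R h x) - (f b - f a) =
          (\<Sum>z\<in>p. measure lborel (snd z) *\<^sub>R h (fst z)) - (\<Sum>z\<in>p. f (Sup (snd z)) - f (Inf (snd z)))"
        by (simp only: split_def)
      also have "\<dots> = (\<Sum>z\<in>p. g z)"
        by (simp only: sum_subtractf[symmetric] g_def split_def)
      also have "norm \<dots> \<le> (\<Sum>z\<in>p. norm (g z))" by (rule norm_sum)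
      also have "\<dots> = (\<Sum>z\<in>p-q. norm (g z)) + (\<Sum>z\<in>q. norm (g z))"
        by (rule sum.subset_diff[OF qp(1) fin])
      also have "\<dots> < e" using 1 2 by simp
      finally show "norm ((\<Sum>(x,k)\<in>p. measure lborel k *\<^sub>R h x) - (f b - f a)) < e" .
    qed
  qed
  then show ?thesis
    by (rule has_integral_spike[OF N, rotated]) (auto simp: h_def)
qed

section \<open>Stability and criteria for absolute continuity\<close>

lemma absolutely_continuous_on_subset:
  assumes "absolutely_continuous_on S f" "T \<subseteq> S"
  shows "absolutely_continuous_on T f"
  using assms unfolding absolutely_continuous_on_def by (meson order_trans)

lemma absolutely_continuous_on_bounded_linear:
  assumes "bounded_linear \<phi>" and AC: "absolutely_continuous_on S f"
  shows "absolutely_continuous_on S (\<lambda>t. \<phi> (f t))"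
  unfolding absolutely_continuous_on_def
proof safe
  fix e :: real assume "e > 0"
  obtain K where K: "K > 0" "\<And>x. norm (\<phi> x) \<le> norm x * K"
    using bounded_linear.pos_bounded[OF assms(1)] by blast
  obtain \<delta> where \<delta>: "\<delta> > 0" and
    AC': "\<And>D. \<lbrakk>D division_of \<Union>D; \<Union>D \<subseteq> S; (\<Sum>K\<in>D. measure lborel K) < \<delta>\<rbrakk> \<Longrightarrow>
      (\<Sum>K\<in>D. dist (f (Inf K)) (f (Sup K))) < e/K"
    using AC \<open>e > 0\<close> K(1) unfolding absolutely_continuous_on_def by (metis divide_pos_pos)
  have "(\<Sum>J\<in>D. dist (\<phi> (f (Inf J))) (\<phi> (f (Sup J)))) < e"
    if "D division_of \<Union>D" "\<Union>D \<subseteq> S" "(\<Sum>K\<in>D. measure lborel K) < \<delta>" for D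
  proof -
    have "(\<Sum>J\<in>D. dist (\<phi> (f (Inf J))) (\<phi> (f (Sup J)))) \<le> (\<Sum>J\<in>D. dist (f (Inf J)) (f (Sup J)) * K)"
      using K(2) by (intro sum_mono) (simp add: dist_norm linear_diff[OF bounded_linear.linear[OF assms(1)], symmetric])
    also have "\<dots> < e" using AC'[OF that] K(1) unfolding sum_distrib_right[symmetric] by (simp add: pos_less_divide_eq)
    finally show ?thesis .
  qed
  then show "\<exists>\<delta>>0. \<forall>D. D division_of \<Union>D \<and> \<Union>D \<subseteq> S \<and> (\<Sum>K\<in>D. measure lborel K) < \<delta> \<longrightarrow>
      (\<Sum>J\<in>D. dist (\<phi> (f (Inf J))) (\<phi> (f (Sup J)))) < e" using \<delta> by blast
qed

lemma absolutely_continuous_on_lipschitz: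
  fixes f :: "real \<Rightarrow> 'a::real_normed_vector"
  assumes lip: "\<And>x y. \<lbrakk>x \<in> S; y \<in> S\<rbrakk> \<Longrightarrow> dist (f x) (f y) \<le> M * \<bar>x - y\<bar>"
  shows "absolutely_continuous_on S f"
  unfolding absolutely_continuous_on_def
proof safe
  fix e :: real assume "e > 0"
  \<comment> \<open>\<open>M\<close> may be zero or negative; \<open>\<bar>M\<bar> + 1\<close> gives
    a positive threshold in every case.\<close>
  have "(\<Sum>K\<in>D. dist (f (Inf K)) (f (Sup K))) < e"
    if D: "D division_of \<Union>D" "\<Union>D \<subseteq> S" and s: "(\<Sum>K\<in>D. measure lborel K) < e / (\<bar>M\<bar> + 1)" for D
  proof -
    have "(\<Sum>K\<in>D. dist (f (Inf K)) (f (Sup K))) \<le> (\<Sum>K\<in>D. (\<bar>M\<bar> + 1) * measure lborel K)"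
    proof (rule sum_mono)
      fix K assume "K \<in> D"
      then obtain u v where K: "K = cbox u v" "K \<noteq> {}" "K \<subseteq> S" using D by (metis Sup_upper division_ofD(3,4) order_trans)
      then have "u \<le> v" "u \<in> S" "v \<in> S" by auto
      then have "dist (f u) (f v) \<le> M * (v - u)" using lip[of u v] by simp
      also have "\<dots> \<le> (\<bar>M\<bar> + 1) * (v - u)" using \<open>u \<le> v\<close> by (intro mult_right_mono) auto
      finally show "dist (f (Inf K)) (f (Sup K)) \<le> (\<bar>M\<bar> + 1) * measure lborel K"
        using K \<open>u \<le> v\<close> by simp
    qed
    also have "\<dots> < e" using s unfolding sum_distrib_left[symmetric] by (simp add: pos_less_divide_eq mult.commute add_nonneg_pos)
    finally show ?thesis .
  qed
  moreover have "e / (\<bar>M\<bar> + 1) > 0" using \<open>e > 0\<close> by (simp add: add_nonneg_pos)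
  ultimately show "\<exists>\<delta>>0. \<forall>D. D division_of \<Union>D \<and> \<Union>D \<subseteq> S \<and> (\<Sum>K\<in>D. measure lborel K) < \<delta> \<longrightarrow>
      (\<Sum>K\<in>D. dist (f (Inf K)) (f (Sup K))) < e" by blast
qed

lemma absolutely_continuous_on_C1:
  fixes f :: "real \<Rightarrow> 'a::real_normed_vector"
  assumes der: "\<And>t. t \<in> {a..b} \<Longrightarrow> (f has_vector_derivative f' t) (at t within {a..b})"
    and cont: "continuous_on {a..b} f'"
  shows "absolutely_continuous_on {a..b} f"
proof -
  have "bounded (f' ` {a..b})" using cont compact_continuous_image compact_imp_bounded by blast
  then obtain M where M: "\<And>t. t \<in> {a..b} \<Longrightarrow> norm (f' t) \<le> M"
    unfolding bounded_iff by blast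
  show ?thesis
  proof (rule absolutely_continuous_on_lipschitz)
    fix x y assume "x \<in> {a..b}" "y \<in> {a..b}"
    then have "norm (f x - f y) \<le> M * norm (x - y)"
      using der M
      by (intro differentiable_bound[where S="{a..b}" and f' = "\<lambda>t h. h *\<^sub>R f' t"])
         (auto simp: has_vector_derivative_def mult.commute[of M] intro!: onorm_bound order_trans[OF norm_ge_zero M]
            mult_left_mono)
    then show "dist (f x) (f y) \<le> M * \<bar>x - y\<bar>" by (simp add: dist_norm)
  qed
qed

text \<open>The increment is the integral of \<open>f'\<close> over \<open>{a..s}\<close>, which
  \<open>h\<close> dominates; since \<open>h\<close> is nonnegative, enlarging the interval to
  \<open>{a..b}\<close> only increases the bound. Thus one bound serves all intermediate times
  \<open>s\<close>.\<close>

lemma absolutely_continuous_norm_diff_le: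
  fixes f :: "real \<Rightarrow> 'a::banach"
  assumes AC: "absolutely_continuous_on {a..b} f" and N: "negligible N"
    and der: "\<And>x. x \<in> {a..b} - N \<Longrightarrow> (f has_vector_derivative f' x) (at x within {a..b})"
    and bd: "\<And>x. x \<in> {a..b} - N \<Longrightarrow> norm (f' x) \<le> h x" and h0: "\<And>x. h x \<ge> 0"
    and h: "(h has_integral I) {a..b}" and s: "s \<in> {a..b}"
  shows "norm (f s - f a) \<le> I"
proof -
  \<comment> \<open>Setting the integrand to 0 on \<open>N\<close> makes the domination by
    \<open>h\<close> hold at every point, not just almost everywhere.\<close>
  define k where "k x = (if x \<in> N then 0 else f' x)" for x
  have "(f' has_integral (f s - f a)) {a..s}"
  proof (rule fundamental_theorem_of_calculus_absolutely_continuous[OF _ _ N])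
    show "absolutely_continuous_on {a..s} f" 
      using s by (intro absolutely_continuous_on_subset[OF AC]) auto
    show "(f has_vector_derivative f' x) (at x within {a..s})" if "x \<in> {a..s} - N" for x
      using s that by (intro has_vector_derivative_within_subset[OF der]) auto
  qed (use s in auto)
  then have k: "(k has_integral (f s - f a)) {a..s}"
    by (rule has_integral_spike[OF N, rotated]) (auto simp: k_def)
  have hs: "h integrable_on {a..s}"
    by (rule integrable_on_subinterval[OF has_integral_integrable[OF h]]) (use s in auto)
  have "norm (integral {a..s} k) \<le> integral {a..s} h"
    
  proof (rule integral_norm_bound_integral[OF has_integral_integrable[OF k] hs])
    fix x assume "x \<in> {a..s}"
    then show "norm (k x) \<le> h x" using bd[of x] h0[of x] s by (simp add: k_def)
  qed
  also have "\<dots> \<le> integral {a..b} h"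
    by (rule integral_subset_le[OF _ hs has_integral_integrable[OF h]]) (use s h0 in auto)
  finally show ?thesis using integral_unique[OF k] integral_unique[OF h] by simp
qed


section \<open>Estimates for the Carnot metric\<close>

text \<open>One constant comes from the boundedness of a bilinear form in finite dimension, the
  other from the positive minimum of \<open>B u u\<close> on the compact unit sphere;
  \<open>M\<close> is the larger of the two.\<close>

lemma inner_product_norm_equiv:
  fixes B :: "'a::euclidean_space \<Rightarrow> 'a \<Rightarrow> real"
  assumes "is_inner_product B"
  obtains M where "M > 0" "\<And>u. norm u \<le> M * sqrt (B u u)" "\<And>u. sqrt (B u u) \<le> M * norm u"
proof -
  have bil: "bilinear B" and pos: "\<And>u. u \<noteq> 0 \<Longrightarrow> B u u > 0"
    using assms by (auto simp: is_inner_product_def)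
  interpret B: bounded_bilinear B using bil bilinear_conv_bounded_bilinear by blast
  have nonneg: "B u u \<ge> 0" for u using pos[of u] B.zero_left[of u] by (cases "u = 0") auto
  obtain K where K: "K > 0" "\<And>u v. norm (B u v) \<le> norm u * norm v * K" using B.pos_bounded by blast
  have up: "sqrt (B u u) \<le> sqrt K * norm u" for u
  proof -
    have "B u u \<le> K * (norm u)\<^sup>2" using K(2)[of u u] by (simp add: power2_eq_square mult_ac)
    then have "sqrt (B u u) \<le> sqrt (K * (norm u)\<^sup>2)" by simp
    then show ?thesis by (simp add: real_sqrt_mult)
  qed
  obtain a :: 'a where "a \<in> Basis" using nonempty_Basis by blast
  then have ne: "sphere (0::'a) 1 \<noteq> {}" by (auto intro!: exI[of _ a])
  have "continuous_on (sphere 0 1) (\<lambda>u. B u u)" by (intro B.continuous_on continuous_on_id)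
  then obtain v where v: "v \<in> sphere 0 1" "\<And>u. u \<in> sphere 0 1 \<Longrightarrow> B v v \<le> B u u"
    using continuous_attains_inf[OF compact_sphere ne] by blast
  define c where "c = B v v"
  have c: "c > 0" using v(1) pos[of v] unfolding c_def by (cases "v = 0") auto
  have lo: "norm u \<le> inverse (sqrt c) * sqrt (B u u)" for u
  proof (cases "u = 0")
    case False
    have "c \<le> B (u /\<^sub>R norm u) (u /\<^sub>R norm u)" using v(2)[of "u /\<^sub>R norm u"] False by (simp add: c_def)
    then have "c * (norm u)\<^sup>2 \<le> B u u"
      using False by (simp add: B.scaleR_left B.scaleR_right field_simps power2_eq_square)
    then have "sqrt (c * (norm u)\<^sup>2) \<le> sqrt (B u u)" by simp
    then show ?thesis using c by (simp add: real_sqrt_mult field_simps)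
  qed (use c nonneg in simp)
  define M where "M = max (sqrt K) (inverse (sqrt c))"
  show ?thesis
  proof
    show "M > 0" using K(1) by (simp add: M_def less_max_iff_disj)
    show "norm u \<le> M * sqrt (B u u)" for u
      using nonneg[of u] by (intro order_trans[OF lo] mult_right_mono) (auto simp: M_def)
    show "sqrt (B u u) \<le> M * norm u" for u
      by (intro order_trans[OF up] mult_right_mono) (auto simp: M_def)
  qed
qed

section \<open>Lower estimates along horizontal curves\<close>

lemma horizontal_curve_imp:
  assumes "horizontal_curve \<gamma> u"
  obtains N where "negligible N" "\<And>t. t \<in> {0..1} - N \<Longrightarrow>
    (\<gamma> has_vector_derivative left_transl_diff (\<gamma> t) (V1_incl (u t))) (at t within {0..1})"
proof -
  obtain N where N: "N \<in> null_sets (lebesgue_on {0..1})"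
    "{t \<in> space (lebesgue_on {0..1}). \<not> (\<gamma> has_vector_derivative left_transl_diff (\<gamma> t) (V1_incl (u t))) (at t within {0..1})} \<subseteq> N"
    using assms by (auto simp: horizontal_curve_def eventually_ae_filter)
  show ?thesis
  proof
    show "negligible N" using N(1) by (simp add: null_sets_restrict_space negligible_iff_null_sets)
    show "(\<gamma> has_vector_derivative left_transl_diff (\<gamma> t) (V1_incl (u t))) (at t within {0..1})"
      if "t \<in> {0..1} - N" for t
      using N(2) that by auto
  qed
qed

lemma bounded_linear_pi1: "bounded_linear pi1"
proof -
  have pi1: "pi1 = (\<lambda>p. (fst p, fst (snd p)))" by (auto simp: pi1_def)
  show ?thesis
    unfolding pi1
    by (intro bounded_linear_Pair bounded_linear_fst bounded_linear_compose[OF bounded_linear_fst bounded_linear_snd])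
qed

text \<open>The crude factor 2 is chosen to cancel the 1/2 of the group law.\<close>

lemma norm_heis_area_le: "norm (a1 * b2 - a2 * b1) \<le> 2 * (norm (a1, a2) * norm (b1, b2))"
  for a1 a2 b1 b2 :: complex
proof -
  have "norm (a1 * b2 - a2 * b1) \<le> norm a1 * norm b2 + norm a2 * norm b1"
    by (metis norm_triangle_ineq4 norm_mult)
  also have "\<dots> \<le> norm (a1, a2) * norm (b1, b2) + norm (a1, a2) * norm (b1, b2)"
    by (intro add_mono mult_mono norm_fst_le norm_snd_le norm_ge_zero)
  finally show ?thesis by simp
qed

text \<open>Since \<open>- p\<close> is the inverse of \<open>p\<close>, this is the vertical part
  of the left invariant difference of \<open>p\<close> and \<open>q\<close>. It has weight two in
  the grading, hence is controlled by the square of the distance.\<close>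

definition heis_gap :: "heis \<Rightarrow> heis \<Rightarrow> complex"
  where "heis_gap p q = snd (snd (heis_mult (- p) q))"

lemma heis_gap_eq: "heis_gap (a1, a2, z) (b1, b2, z') = z' - z - (a1 * b2 - a2 * b1) / 2"
  by (simp add: heis_gap_def heis_mult_def scaleR_conv_of_real field_simps)

text \<open>The projected curve has velocity \<open>u\<close>, so it stays within
  \<open>M * L\<close> of its start. The gap grows at a rate of at most this displacement times the
  norm of \<open>u\<close>, and a second integration gives the square.\<close>

lemma horizontal_curve_bounds:
  assumes hor: "horizontal_curve \<gamma> u"
    and L: "((\<lambda>t. sqrt (B (u t) (u t))) has_integral L) {0..1}"
    and M: "M > 0" "\<And>u. norm u \<le> M * sqrt (B u u)"
  shows "norm (pi1 (\<gamma> 1) - pi1 (\<gamma> 0)) \<le> M * L" "norm (heis_gap (\<gamma> 0) (\<gamma> 1)) \<le> (M * L)\<^sup>2"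
    "0 \<le> L"
proof -
  define h where "h t = M * sqrt (B (u t) (u t))" for t
  have AC: "absolutely_continuous_on {0..1} \<gamma>" using hor by (simp add: horizontal_curve_def)
  obtain N where N: "negligible N" "\<And>t. t \<in> {0..1} - N \<Longrightarrow>
      (\<gamma> has_vector_derivative left_transl_diff (\<gamma> t) (V1_incl (u t))) (at t within {0..1})"
    using horizontal_curve_imp[OF hor] by blast
  have h: "(h has_integral M * L) {0..1}" unfolding h_def by (rule has_integral_mult_right[OF L])
  have uh: "norm (u t) \<le> h t" for t using M(2) by (simp add: h_def)
  then have h0: "h t \<ge> 0" for t using norm_ge_zero order_trans by blast
  have ML0: "0 \<le> M * L" using has_integral_nonneg[OF h] h0 by simp
  then show "0 \<le> L" using M(1) by (simp add: zero_le_mult_iff)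
  have pi1_le: "norm (pi1 (\<gamma> t) - pi1 (\<gamma> 0)) \<le> M * L" if t: "t \<in> {0..1}" for t
  proof (rule absolutely_continuous_norm_diff_le[OF _ N(1) _ _ h0 h t])
    show "absolutely_continuous_on {0..1} (\<lambda>t. pi1 (\<gamma> t))"
      by (rule absolutely_continuous_on_bounded_linear[OF bounded_linear_pi1 AC])
    show "((\<lambda>t. pi1 (\<gamma> t)) has_vector_derivative u t) (at t within {0..1})" if "t \<in> {0..1} - N" for t
    proof -
      have "u t = pi1 (left_transl_diff (\<gamma> t) (V1_incl (u t)))"
        by (cases "\<gamma> t"; cases "u t") (simp add: pi1_def left_transl_diff_def V1_incl_def)
      then show ?thesis
        using bounded_linear.has_vector_derivative[OF bounded_linear_pi1 N(2)[OF that]] by simp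
    qed
  qed (use uh in auto)
  then show "norm (pi1 (\<gamma> 1) - pi1 (\<gamma> 0)) \<le> M * L" by simp
  \<comment> \<open>Replacing the third coordinate \<open>z0\<close> of the base point by 0 turns
    the gap from an affine into a linear function; the difference of its values at the two ends is
    still the gap from \<open>\<gamma> 0\<close> to \<open>\<gamma> 1\<close>.\<close>
  obtain a1 a2 z0 where g0: "\<gamma> 0 = (a1, a2, z0)" by (cases "\<gamma> 0")
  have bl: "bounded_linear (heis_gap (a1, a2, 0))"
    unfolding linear_conv_bounded_linear[symmetric]
    by (rule linearI; clarsimp simp: heis_gap_eq scaleR_conv_of_real field_simps)
  have "norm (heis_gap (a1, a2, 0) (\<gamma> 1) - heis_gap (a1, a2, 0) (\<gamma> 0)) \<le> (M * L) * (M * L)"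
  proof (rule absolutely_continuous_norm_diff_le[OF _ N(1), where h = "\<lambda>t. (M * L) * h t"])
    show "absolutely_continuous_on {0..1} (\<lambda>t. heis_gap (a1, a2, 0) (\<gamma> t))"
      by (rule absolutely_continuous_on_bounded_linear[OF bl AC])
    fix t assume t: "t \<in> {0..1} - N"
    show "((\<lambda>t. heis_gap (a1, a2, 0) (\<gamma> t)) has_vector_derivative
        heis_gap (a1, a2, 0) (left_transl_diff (\<gamma> t) (V1_incl (u t)))) (at t within {0..1})"
      by (rule bounded_linear.has_vector_derivative[OF bl N(2)[OF t]])
    obtain w1 w2 z where gt: "\<gamma> t = (w1, w2, z)" by (cases "\<gamma> t")
    obtain u1 u2 where ut: "u t = (u1, u2)" by fastforce
    have "heis_gap (a1, a2, 0) (left_transl_diff (\<gamma> t) (V1_incl (u t)))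
        = ((w1 - a1) * u2 - (w2 - a2) * u1) / 2"
      by (simp add: gt ut heis_gap_eq left_transl_diff_def V1_incl_def scaleR_conv_of_real field_simps)
    also have "norm \<dots> \<le> norm (w1 - a1, w2 - a2) * norm (u1, u2)"
      using norm_heis_area_le[of "w1 - a1" u2 "w2 - a2" u1] by (simp add: norm_divide)
    also have "(w1 - a1, w2 - a2) = pi1 (\<gamma> t) - pi1 (\<gamma> 0)" by (simp add: gt g0 pi1_def)
    also have "norm \<dots> * norm (u1, u2) \<le> (M * L) * h t"
      using pi1_le[of t] uh[of t] t ut ML0 by (intro mult_mono) auto
    finally show "norm (heis_gap (a1, a2, 0) (left_transl_diff (\<gamma> t) (V1_incl (u t)))) \<le> (M * L) * h t" .
  qed (use ML0 h0 has_integral_mult_right[OF h] in auto)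
  moreover obtain b1 b2 z1 where "\<gamma> 1 = (b1, b2, z1)" by (cases "\<gamma> 1")
  ultimately show "norm (heis_gap (\<gamma> 0) (\<gamma> 1)) \<le> (M * L)\<^sup>2"
    by (simp add: g0 heis_gap_eq power2_eq_square algebra_simps)
qed

section \<open>Explicit horizontal curves and the resulting bounds for the metric\<close>

lemma horizontal_curve_C1:
  assumes der: "\<And>t. t \<in> {0..1} \<Longrightarrow>
      (\<gamma> has_vector_derivative left_transl_diff (\<gamma> t) (V1_incl (u t))) (at t within {0..1})"
    and cont: "continuous_on {0..1} u"
  shows "horizontal_curve \<gamma> u"
  unfolding horizontal_curve_def
proof
  have "continuous_on {0..1} \<gamma>"
    by (rule continuous_on_vector_derivative[OF der])
  \<comment> \<open>Written with projections, the velocity is a polynomial in the components of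
    \<open>\<gamma>\<close> and \<open>u\<close>, hence continuous, and \<open>\<gamma>\<close> is
    continuously differentiable.\<close>
  moreover have "(\<lambda>t. left_transl_diff (\<gamma> t) (V1_incl (u t))) = (\<lambda>t. (fst (u t), snd (u t),
      (1/2) *\<^sub>R (fst (\<gamma> t) * snd (u t) - fst (snd (\<gamma> t)) * fst (u t))))"
  proof
    fix t show "left_transl_diff (\<gamma> t) (V1_incl (u t)) = (fst (u t), snd (u t),
      (1/2) *\<^sub>R (fst (\<gamma> t) * snd (u t) - fst (snd (\<gamma> t)) * fst (u t)))"
      by (cases "\<gamma> t"; cases "u t") (simp add: left_transl_diff_def V1_incl_def)
  qed
  ultimately have "continuous_on {0..1} (\<lambda>t. left_transl_diff (\<gamma> t) (V1_incl (u t)))"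
    using cont by (simp only:) (intro continuous_intros)
  then show "absolutely_continuous_on {0..1} \<gamma>"
    using absolutely_continuous_on_C1[OF der] by blast
  show "AE t in lebesgue_on {0..1}.
      (\<gamma> has_vector_derivative left_transl_diff (\<gamma> t) (V1_incl (u t))) (at t within {0..1})"
    using der by (intro AE_I2) auto
qed

lemma continuous_on_inner_product:
  fixes B :: "'a::euclidean_space \<Rightarrow> 'a \<Rightarrow> real"
  assumes "is_inner_product B" "continuous_on S u"
  shows "continuous_on S (\<lambda>t. sqrt (B (u t) (u t)))"
proof -
  interpret B: bounded_bilinear B
    using assms(1) bilinear_conv_bounded_bilinear by (auto simp: is_inner_product_def)
  show ?thesis by (intro continuous_on_real_sqrt B.continuous_on assms(2))
qed

text \<open>The infimum of an empty set of reals carries no information, so lower bounds for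
  \<open>carnot_dist\<close> require a connecting curve of finite length. A polynomial one is
  written down explicitly.\<close>

lemma ex_horizontal_curve:
  assumes B: "is_inner_product B"
  shows "\<exists>\<gamma> u L. horizontal_curve \<gamma> u \<and> \<gamma> 0 = p \<and> \<gamma> 1 = q \<and>
    ((\<lambda>t. sqrt (B (u t) (u t))) has_integral L) {0..1}"
proof -
  obtain p1 p2 p3 where p: "p = (p1, p2, p3)" by (cases p)
  obtain q1 q2 q3 where q: "q = (q1, q2, q3)" by (cases q)
  note pq = p q
  \<comment> \<open>These are the coordinates of the product of \<open>- p\<close> and
    \<open>q\<close>: the curve is built from the origin to this point and then left translated by
    \<open>p\<close>.\<close>
  define a b c where "a = q1 - p1" and "b = q2 - p2" and "c = q3 - p3 - (p1 * q2 - p2 * q1) / 2"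
  \<comment> \<open>The segment from \<open>(0, 0)\<close> to \<open>(a, b)\<close> is perturbed by \<open>(t - t\<^sup>2, e (t - 3 t\<^sup>2 + 2 t\<^sup>3))\<close>, which vanishes at both
    ends; the area it encloses is \<open>b / 6 - e / 30\<close>, and \<open>e\<close> is chosen to make it \<open>c\<close>.\<close>
  define e where "e = 5 * b - 30 * c"
  define W1 W2 Z where
    "W1 t = a * of_real t + (of_real t - of_real t ^ 2)"
    and "W2 t = b * of_real t + e * (of_real t - 3 * of_real t ^ 2 + 2 * of_real t ^ 3)"
    and "Z t = (a * e * (of_real t ^ 4 - of_real t ^ 3) + b * (of_real t ^ 3 / 3)
       + e * (- 2 * of_real t ^ 3 / 3 + of_real t ^ 4 - 2 * of_real t ^ 5 / 5)) / 2" for t :: real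
  define u1 u2 where "u1 t = a + (1 - 2 * of_real t)"
    and "u2 t = b + e * (1 - 6 * of_real t + 6 * of_real t ^ 2)" for t :: real
  define \<gamma> where "\<gamma> t = (p1 + W1 t, p2 + W2 t, p3 + Z t + (p1 * W2 t - p2 * W1 t) / 2)" for t
  have W1: "(W1 has_vector_derivative u1 t) (at t within S)" for t S
    unfolding W1_def[abs_def] u1_def
    by (auto intro!: derivative_eq_intros has_vector_derivative_real_field simp: algebra_simps)
  have W2: "(W2 has_vector_derivative u2 t) (at t within S)" for t S
    unfolding W2_def[abs_def] u2_def
    by (auto intro!: derivative_eq_intros has_vector_derivative_real_field simp: algebra_simps)
  \<comment> \<open>Horizontality at the origin means that \<open>Z\<close> is the primitive, with
    \<open>Z 0 = 0\<close>, of half the area form along \<open>(W1, W2)\<close>.\<close>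
  have Z: "(Z has_vector_derivative (W1 t * u2 t - W2 t * u1 t) / 2) (at t within S)" for t S
    unfolding W1_def[abs_def] W2_def[abs_def] Z_def[abs_def] u1_def u2_def
    by (auto intro!: derivative_eq_intros has_vector_derivative_real_field simp: field_simps eval_nat_numeral)
  have "horizontal_curve \<gamma> (\<lambda>t. (u1 t, u2 t))"
  proof (rule horizontal_curve_C1)
    fix t :: real
    \<comment> \<open>The zeros are the derivatives of \<open>p1\<close>, \<open>p2\<close>,
      \<open>p3\<close>, kept so that the triple has the shape produced by the sum rule.\<close>
    have "left_transl_diff (\<gamma> t) (V1_incl (u1 t, u2 t)) =
      (0 + u1 t, 0 + u2 t, 0 + (W1 t * u2 t - W2 t * u1 t) / 2 + (p1 * u2 t - p2 * u1 t) / 2)"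
      by (simp add: \<gamma>_def left_transl_diff_def V1_incl_def scaleR_conv_of_real field_simps)
    moreover have "(\<gamma> has_vector_derivative 
      (0 + u1 t, 0 + u2 t, 0 + (W1 t * u2 t - W2 t * u1 t) / 2 + (p1 * u2 t - p2 * u1 t) / 2)) (at t within {0..1})"
      unfolding \<gamma>_def[abs_def]
      by (intro has_vector_derivative_Pair has_vector_derivative_add has_vector_derivative_divide
          has_vector_derivative_diff has_vector_derivative_mult_right has_vector_derivative_const W1 W2 Z)
    ultimately show "(\<gamma> has_vector_derivative left_transl_diff (\<gamma> t) (V1_incl (u1 t, u2 t))) (at t within {0..1})"
      by simp
  next
    show cont: "continuous_on {0..1} (\<lambda>t. (u1 t, u2 t))"
      unfolding u1_def u2_def by (intro continuous_intros)
  qed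
  moreover have "\<gamma> 0 = p" by (simp add: \<gamma>_def W1_def W2_def Z_def pq)
  moreover have "\<gamma> 1 = q"
    by (simp add: \<gamma>_def W1_def W2_def Z_def pq a_def b_def c_def e_def field_simps)
  moreover have "continuous_on {0..1} (\<lambda>t. (u1 t, u2 t))"
    unfolding u1_def u2_def by (intro continuous_intros)
  then have "(\<lambda>t. sqrt (B (u1 t, u2 t) (u1 t, u2 t))) integrable_on {0..1}"
    by (intro integrable_continuous_real continuous_on_inner_product[OF B])
  ultimately show ?thesis by blast
qed

text \<open>The left translate by \<open>p\<close> of the one-parameter subgroup of \<open>v\<close>
  is horizontal with constant velocity \<open>v\<close>, so its length is
  \<open>sqrt (B v v)\<close>.\<close>

lemma carnot_dist_le_horizontal:
  assumes B: "is_inner_product B"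
  shows "carnot_dist B p (heis_mult p (V1_incl v)) \<le> sqrt (B v v)"
proof -
  obtain p1 p2 p3 where p: "p = (p1, p2, p3)" by (cases p)
  obtain v1 v2 where v: "v = (v1, v2)" by (cases v)
  note pv = p v
  define \<gamma> where "\<gamma> t = heis_mult p (t *\<^sub>R V1_incl v)" for t
  have \<gamma>_eq: "\<gamma> t = (p1, p2, p3) + t *\<^sub>R (v1, v2, (p1 * v2 - p2 * v1) / 2)" for t
    by (simp add: \<gamma>_def pv heis_mult_def V1_incl_def scaleR_conv_of_real algebra_simps diff_divide_distrib)
  have "horizontal_curve \<gamma> (\<lambda>_. v)"
  proof (rule horizontal_curve_C1)
    fix t :: real
    have "left_transl_diff (\<gamma> t) (V1_incl v) = (v1, v2, (p1 * v2 - p2 * v1) / 2)"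
      unfolding \<gamma>_eq by (simp add: left_transl_diff_def pv V1_incl_def scaleR_conv_of_real algebra_simps)
    then show "(\<gamma> has_vector_derivative left_transl_diff (\<gamma> t) (V1_incl v)) (at t within {0..1})"
      unfolding \<gamma>_eq[abs_def] by (auto intro!: derivative_eq_intros)
  qed simp
  moreover have "\<gamma> 0 = p" "\<gamma> 1 = heis_mult p (V1_incl v)"
    by (simp_all add: \<gamma>_def heis_mult_zero)
  moreover have "((\<lambda>t. sqrt (B v v)) has_integral sqrt (B v v)) {0..1::real}"
    using has_integral_const_real[of "sqrt (B v v)" 0 1] by simp
  ultimately have mem: "sqrt (B v v) \<in> {L. \<exists>\<gamma> u. horizontal_curve \<gamma> u \<and> \<gamma> 0 = p \<and>
      \<gamma> 1 = heis_mult p (V1_incl v) \<and> ((\<lambda>t. sqrt (B (u t) (u t))) has_integral L) {0..1}}"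
    by (intro CollectI exI[of _ \<gamma>] exI[of _ "\<lambda>_. v"]) simp
  \<comment> \<open>\<open>M\<close> serves to show that lengths are nonnegative, so that the
    infimum is taken over a set bounded below.\<close>
  obtain M where M: "M > 0" "\<And>u. norm u \<le> M * sqrt (B u u)"
    by (rule inner_product_norm_equiv[OF B]) (rule that)
  show ?thesis
    unfolding carnot_dist_def
  proof (rule cInf_lower[OF mem bdd_belowI[of _ 0]], clarify)
    fix L \<gamma> u assume "horizontal_curve \<gamma> u" "((\<lambda>t. sqrt (B (u t) (u t))) has_integral L) {0..1}"
    then show "0 \<le> L"
      by (rule horizontal_curve_bounds(3)[of \<gamma> u B L M]) (fact M)+
  qed
qed

lemma carnot_dist_lower_bounds:
  assumes B: "is_inner_product B" and M: "M > 0" "\<And>u. norm u \<le> M * sqrt (B u u)"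
  shows "norm (pi1 q - pi1 p) \<le> M * carnot_dist B p q"
    "norm (heis_gap p q) \<le> (M * carnot_dist B p q)\<^sup>2"
    "0 \<le> carnot_dist B p q"
proof -
  define S where "S = {L. \<exists>\<gamma> u. horizontal_curve \<gamma> u \<and> \<gamma> 0 = p \<and> \<gamma> 1 = q \<and>
      ((\<lambda>t. sqrt (B (u t) (u t))) has_integral L) {0..1}}"
  have d: "carnot_dist B p q = Inf S" by (simp add: carnot_dist_def S_def)
  have ne: "S \<noteq> {}" using ex_horizontal_curve[OF B, of p q] by (auto simp: S_def)
  have bd: "norm (pi1 q - pi1 p) \<le> M * L" "norm (heis_gap p q) \<le> (M * L)\<^sup>2" "0 \<le> L" if LS: "L \<in> S" for L
    
  proof -
    obtain \<gamma> u where "horizontal_curve \<gamma> u" "\<gamma> 0 = p" "\<gamma> 1 = q"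
      "((\<lambda>t. sqrt (B (u t) (u t))) has_integral L) {0..1}"
      using LS unfolding S_def by blast
    note bounds = horizontal_curve_bounds[of \<gamma> u B L M, OF this(1,4) M, unfolded this(2,3)]
    show "norm (pi1 q - pi1 p) \<le> M * L" "norm (heis_gap p q) \<le> (M * L)\<^sup>2" "0 \<le> L"
      by (fact bounds)+
  qed
  have "norm (pi1 q - pi1 p) / M \<le> Inf S"
    using bd(1) M(1) by (intro cInf_greatest[OF ne]) (simp add: field_simps)
  then show "norm (pi1 q - pi1 p) \<le> M * carnot_dist B p q"
    using M(1) by (simp add: d field_simps)
  show d0: "0 \<le> carnot_dist B p q" unfolding d using bd(3) by (intro cInf_greatest[OF ne])
  \<comment> \<open>After taking the square root the bound is linear in \<open>L\<close> and passes
    to the infimum.\<close>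
  have "sqrt (norm (heis_gap p q)) / M \<le> Inf S"
  proof (intro cInf_greatest[OF ne])
    fix L assume L: "L \<in> S"
    have "sqrt (norm (heis_gap p q)) \<le> M * L" using bd(2,3)[OF L] M(1) by (intro real_le_lsqrt) auto
    then show "sqrt (norm (heis_gap p q)) / M \<le> L" using M(1) by (simp add: field_simps)
  qed
  then have "sqrt (norm (heis_gap p q)) \<le> M * carnot_dist B p q"
    using M(1) by (simp add: d field_simps)
  then show "norm (heis_gap p q) \<le> (M * carnot_dist B p q)\<^sup>2"
    by (rule sqrt_le_D)
qed


section \<open>Quasiconformal liftings\<close>

text \<open>A positive numerator over 0 is infinite, so if \<open>i\<close> vanishes the strict
  bound forces \<open>s = 0\<close>, the quotient being then 0. Otherwise \<open>i\<close> is finite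
  and positive and the division can be cleared.\<close>

lemma ereal_le_mult_of_divide_less:
  fixes s i :: ereal
  assumes "s / i < ereal H" "0 \<le> s" "0 \<le> i" "i \<le> ereal c"
  shows "s \<le> ereal (H * c)"
proof -
  obtain j where j: "i = ereal j" "0 \<le> j" "j \<le> c" using assms(3,4) by (cases i) auto
  show ?thesis
  proof (cases "j = 0")
    case True
    then have "s = 0" using assms(1,2) j
      by (cases s) (auto simp: divide_ereal_def split: if_splits)
    moreover have "0 \<le> H" using assms(1) \<open>s = 0\<close> by simp
    ultimately show ?thesis using j by simp
  next
    case False
    then obtain t where t: "s = ereal t" "0 \<le> t" using assms(1,2) j by (cases s) auto
    then have "t / j < H" using assms(1) j False by simp
    moreover have "0 \<le> t / j" using t j by simp
    ultimately have "0 \<le> H" by linarith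
    moreover have "t < H * j" using \<open>t / j < H\<close> j False by (simp add: field_simps)
    ultimately have "t \<le> H * c" using j mult_left_mono[of j c H] by linarith
    then show ?thesis using t by simp
  qed
qed

lemma is_liftingD: "is_lifting F f \<Longrightarrow> pi1 (F x) = f (pi1 x)"
  unfolding is_lifting_def by blast

text \<open>Only the radius depends on \<open>x\<close>. The uniformity of \<open>K\<close> is what
  later bounds the derivative of \<open>g\<close> on the whole plane.\<close>

lemma quasiconformal_local_bound:
  assumes B: "is_inner_product B" and qc: "quasiconformal UNIV (carnot_dist B) F"
    and lift: "is_lifting F f" and f: "\<And>w1 w2. f (w1, w2) = (w1, w2 + g w1)"
  obtains K where "K > 0"
    "\<And>x. \<exists>r0>0. \<forall>r y. 0 < r \<and> r < r0 \<and> carnot_dist B x y \<le> r \<longrightarrow> carnot_dist B (F x) (F y) \<le> K * r"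
proof -
  let ?d = "carnot_dist B"
  obtain M where M: "M > 0" "\<And>u. norm u \<le> M * sqrt (B u u)" "\<And>u. sqrt (B u u) \<le> M * norm u"
    by (rule inner_product_norm_equiv[OF B]) (rule that)
  have d0: "0 \<le> ?d p q" for p q using carnot_dist_lower_bounds(3)[OF B M(1,2)] .
  obtain H0 where H0: "\<And>x. Limsup (at_right 0) (\<lambda>r.
         (SUP y\<in>{y\<in>UNIV. ?d x y \<le> r}. ereal (?d (F x) (F y))) /
         (INF y\<in>{y\<in>UNIV. ?d x y \<ge> r}. ereal (?d (F x) (F y)))) \<le> ereal H0"
    using qc unfolding quasiconformal_def by blast
  \<comment> \<open>The increase by 1 makes the bound on the upper limit strict, so that it holds
    for all small \<open>r\<close>; the absolute value makes \<open>H\<close> positive.\<close>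
  define H where "H = \<bar>H0\<bar> + 1"
  have inf_le: "(INF y\<in>{y. ?d x y \<ge> r}. ereal (?d (F x) (F y))) \<le> ereal (M\<^sup>2 * r)" if "r > 0" for x r
  proof -
    obtain w1 w2 z where x: "x = (w1, w2, z)" by (cases x)
    \<comment> \<open>The shift by \<open>M * r\<close> is just large enough that every point over
      the shifted base point is at distance at least \<open>r\<close> from \<open>x\<close>.\<close>
    define v where "v = (0::complex, of_real (M * r) :: complex)"
    have nv: "norm v = M * r" using M(1) \<open>r > 0\<close> by (simp add: v_def norm_Pair norm_mult)
    have "pi1 (F x) = f (w1, w2)"
      using is_liftingD[OF lift, of x] by (simp add: x pi1_def)
    then have "pi1 (heis_mult (F x) (V1_incl v)) = f (w1, w2 + of_real (M * r))"
      by (cases "F x") (simp add: f v_def pi1_def heis_mult_def V1_incl_def)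
    \<comment> \<open>As \<open>g\<close> depends on \<open>w1\<close> alone, \<open>f\<close>
      commutes with the shift; since \<open>F\<close> is onto the image fibre, the endpoint of the
      short horizontal segment from \<open>F x\<close> has a preimage over the shifted
      point.\<close>
    then have "heis_mult (F x) (V1_incl v) \<in> F ` (pi1 -` {(w1, w2 + of_real (M * r))})"
      using lift unfolding is_lifting_def by simp
    then obtain y where y: "pi1 y = (w1, w2 + of_real (M * r))" "F y = heis_mult (F x) (V1_incl v)"
      by auto
    have "M * r = norm (pi1 y - pi1 x)" 
    proof -
      have "pi1 y - pi1 x = v" unfolding y(1) by (simp add: x pi1_def v_def)
      then show ?thesis by (simp only: nv)
    qed
    also have "\<dots> \<le> M * ?d x y" using carnot_dist_lower_bounds(1)[OF B M(1,2)] .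
    finally have "r \<le> ?d x y" using M(1) by simp
    moreover have "?d (F x) (F y) \<le> M\<^sup>2 * r"
      using carnot_dist_le_horizontal[OF B, of "F x" v] M(3)[of v] by (simp add: y nv power2_eq_square)
    ultimately show ?thesis by (intro INF_lower2[of y]) auto
  qed
  show ?thesis
  proof
    show "H * M\<^sup>2 > 0" using M(1) by (simp add: H_def)
    fix x
    have "Limsup (at_right 0) (\<lambda>r.
         (SUP y\<in>{y\<in>UNIV. ?d x y \<le> r}. ereal (?d (F x) (F y))) /
         (INF y\<in>{y\<in>UNIV. ?d x y \<ge> r}. ereal (?d (F x) (F y)))) < ereal H"
      by (rule le_less_trans[OF H0]) (simp add: H_def)
    from Limsup_lessD[OF this] obtain r0 where r0: "r0 > 0" "\<And>r. 0 < r \<Longrightarrow> r < r0 \<Longrightarrow>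
         (SUP y\<in>{y. ?d x y \<le> r}. ereal (?d (F x) (F y))) /
         (INF y\<in>{y. ?d x y \<ge> r}. ereal (?d (F x) (F y))) < ereal H"
      by (auto simp: eventually_at_right_field)
    have "?d (F x) (F y) \<le> H * M\<^sup>2 * r" if "0 < r" "r < r0" "?d x y \<le> r" for r y
    proof -
      have le: "ereal (?d (F x) (F y)) \<le> (SUP y\<in>{y. ?d x y \<le> r}. ereal (?d (F x) (F y)))"
        using that(3) by (intro SUP_upper) simp
      have "(SUP y\<in>{y. ?d x y \<le> r}. ereal (?d (F x) (F y))) \<le> ereal (H * (M\<^sup>2 * r))"
      proof (rule ereal_le_mult_of_divide_less[OF r0(2)[OF that(1,2)] _ _ inf_le[OF that(1)]])
        show "0 \<le> (SUP y\<in>{y. ?d x y \<le> r}. ereal (?d (F x) (F y)))"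
          by (rule order_trans[OF _ le]) (simp add: d0)
        show "0 \<le> (INF y\<in>{y. ?d x y \<ge> r}. ereal (?d (F x) (F y)))"
          by (intro INF_greatest) (simp add: d0)
      qed
      with le have "ereal (?d (F x) (F y)) \<le> ereal (H * (M\<^sup>2 * r))" by (rule order_trans)
      then show ?thesis by (simp add: mult.assoc)
    qed
    then show "\<exists>r0>0. \<forall>r y. 0 < r \<and> r < r0 \<and> ?d x y \<le> r \<longrightarrow> ?d (F x) (F y) \<le> H * M\<^sup>2 * r"
      using r0(1) by blast
  qed
qed

section \<open>Complex differentiability and Liouville's theorem\<close>

lemma DERIV_of_quadratic_error:
  fixes f :: "complex \<Rightarrow> complex"
  assumes r0: "r0 > 0" and bd: "\<And>b. norm (b - a) < r0 \<Longrightarrow> norm (f b - f a - (b - a) * D) \<le> C * (norm (b - a))\<^sup>2"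
  shows "(f has_field_derivative D) (at a)"
  unfolding has_field_derivative_iff
proof (rule LIM_zero_cancel, rule Lim_null_comparison)
  have "\<forall>\<^sub>F b in at a. norm (b - a) < r0 \<and> b \<noteq> a"
    using r0 by (auto simp: eventually_at dist_norm)
  then show "\<forall>\<^sub>F b in at a. norm ((f b - f a) / (b - a) - D) \<le> C * norm (b - a)"
  proof eventually_elim
    case (elim b)
    then have "(f b - f a) / (b - a) - D = (f b - f a - (b - a) * D) / (b - a)" by (simp add: field_simps)
    then show ?case using bd[of b] elim by (simp add: norm_divide pos_divide_le_eq power2_eq_square mult.assoc)
  qed
  show "((\<lambda>b. C * norm (b - a)) \<longlongrightarrow> 0) (at a)"
    by (auto intro!: tendsto_eq_intros)
qed

text \<open>The radius may vary with \<open>a\<close>, since only limits of difference quotients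
  matter, but the common \<open>C\<close> bounds \<open>deriv g\<close> everywhere. Liouville makes
  it a constant \<open>c\<close>, and \<open>g w - c * w\<close> has derivative zero.\<close>

lemma entire_affine:
  fixes g :: "complex \<Rightarrow> complex"
  assumes hol: "g holomorphic_on UNIV"
    and lip: "\<And>a. \<exists>r0>0. \<forall>b. norm (b - a) < r0 \<longrightarrow> norm (g b - g a) \<le> C * norm (b - a)"
  shows "\<exists>a b. \<forall>w. g w = a * w + b"
proof -
  have der: "(g has_field_derivative deriv g a) (at a)" for a
    using holomorphic_derivI[OF hol open_UNIV] by simp
  have "norm (deriv g a) \<le> C" for a
  proof -
    have lim: "((\<lambda>b. (g b - g a) / (b - a)) \<longlongrightarrow> deriv g a) (at a)"
      using der unfolding has_field_derivative_iff .
    obtain r0 where r0: "r0 > 0" "\<And>b. norm (b - a) < r0 \<Longrightarrow> norm (g b - g a) \<le> C * norm (b - a)"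
      using lip by blast
    have "\<forall>\<^sub>F b in at a. norm (b - a) < r0 \<and> b \<noteq> a"
      using r0(1) by (auto simp: eventually_at dist_norm)
    then have "\<forall>\<^sub>F b in at a. norm ((g b - g a) / (b - a)) \<le> C"
      by eventually_elim (use r0(2) in \<open>simp add: norm_divide field_simps\<close>)
    then show ?thesis using Lim_norm_ubound[OF _ lim] by simp
  qed
  then have "bounded (range (deriv g))" by (auto simp: bounded_iff)
  then obtain c where c: "\<And>a. deriv g a = c"
    using Liouville_theorem[OF holomorphic_deriv[OF hol open_UNIV]] by (auto simp: constant_on_def)
  have "((\<lambda>w. g w - c * w) has_field_derivative 0) (at w)" for w
    using der[of w] by (auto intro!: derivative_eq_intros simp: c)
  then have "\<exists>k. \<forall>w\<in>UNIV. g w - c * w = k"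
    by (intro has_field_derivative_zero_constant) auto
  then show ?thesis by (metis UNIV_I add.commute diff_add_cancel)
qed

theorem proposition4p3:
  fixes B :: "complex \<times> complex \<Rightarrow> complex \<times> complex \<Rightarrow> real"
    and F :: "heis \<Rightarrow> heis"
    and f :: "complex \<times> complex \<Rightarrow> complex \<times> complex"
    and g :: "complex \<Rightarrow> complex"
  assumes "is_inner_product B"
    and "quasiconformal UNIV (carnot_dist B) F"
    and "is_lifting F f"
    and "\<And>w1 w2. f (w1, w2) = (w1, w2 + g w1)"
  shows "\<exists>a b. \<forall>w1. g w1 = a * w1 + b"
proof -
  note B = assms(1)
  let ?d = "carnot_dist B"
  obtain M where M: "M > 0" "\<And>u. norm u \<le> M * sqrt (B u u)" "\<And>u. sqrt (B u u) \<le> M * norm u"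
    by (rule inner_product_norm_equiv[OF B]) (rule that)
  obtain K where K: "K > 0"
    "\<And>x. \<exists>r0>0. \<forall>r y. 0 < r \<and> r < r0 \<and> ?d x y \<le> r \<longrightarrow> ?d (F x) (F y) \<le> K * r"
    using quasiconformal_local_bound[OF assms] by blast
  define Z where "Z w = snd (snd (F (w, 0, 0)))" for w
  have F: "F (w, 0, 0) = (w, g w, Z w)" for w
  proof -
    have "pi1 (F (w, 0, 0)) = f (w, 0)"
      using is_liftingD[OF assms(3), of "(w, 0, 0)"] by (simp add: pi1_def)
    then show ?thesis by (cases "F (w, 0, 0)") (simp add: Z_def pi1_def assms(4))
  qed
  \<comment> \<open>The right factor \<open>M\<close> compares the Euclidean norm with the metric in
    the source, \<open>K\<close> is the local Lipschitz constant of \<open>F\<close>, and the left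
    \<open>M\<close> returns to Euclidean quantities in the target.\<close>
  define C where "C = M * (K * M)"
  have loc: "\<exists>r0>0. \<forall>b. norm (b - a) < r0 \<longrightarrow>
      norm (g b - g a) \<le> C * norm (b - a) \<and>
      norm (Z b - Z a - (a * g b - g a * b) / 2) \<le> (C * norm (b - a))\<^sup>2" for a
  proof -
    obtain r0 where r0: "r0 > 0"
      "\<And>r y. \<lbrakk>0 < r; r < r0; ?d (a, 0, 0) y \<le> r\<rbrakk> \<Longrightarrow> ?d (F (a, 0, 0)) (F y) \<le> K * r"
      using K(2) by blast
    have "norm (g b - g a) \<le> C * norm (b - a) \<and>
      norm (Z b - Z a - (a * g b - g a * b) / 2) \<le> (C * norm (b - a))\<^sup>2" if b: "norm (b - a) < r0 / M" for b
    proof (cases "b = a")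
      case False
      let ?r = "M * norm (b - a)"
      \<comment> \<open>The complex line of the points \<open>(w, 0, 0)\<close> is horizontal, as
        the area term vanishes on it, so distances along it are at most a multiple of Euclidean
        ones.\<close>
      have "heis_mult (a, 0, 0) (V1_incl (b - a, 0)) = (b, 0, 0)" by (simp add: heis_mult_def V1_incl_def)
      then have "?d (a, 0, 0) (b, 0, 0) \<le> ?r"
        using carnot_dist_le_horizontal[OF B, of "(a, 0, 0)" "(b - a, 0)"] M(3)[of "(b - a, 0)"]
        by (simp add: norm_Pair)
      then have "?d (F (a, 0, 0)) (F (b, 0, 0)) \<le> K * ?r"
        using r0(2)[of ?r] b False M(1) by (simp add: field_simps)
      then have d: "M * ?d (F (a, 0, 0)) (F (b, 0, 0)) \<le> C * norm (b - a)"
        using M(1) by (simp add: C_def mult.assoc)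
      note lb = carnot_dist_lower_bounds[OF B M(1,2), where p = "F (a, 0, 0)" and q = "F (b, 0, 0)"]
      have "norm (g b - g a) \<le> norm (pi1 (F (b, 0, 0)) - pi1 (F (a, 0, 0)))"
        by (simp add: F pi1_def norm_snd_le)
      also have "\<dots> \<le> C * norm (b - a)" using lb(1) d by linarith
      finally have "norm (g b - g a) \<le> C * norm (b - a)" .
      moreover have "norm (heis_gap (F (a, 0, 0)) (F (b, 0, 0))) \<le> (C * norm (b - a))\<^sup>2"
        by (rule order_trans[OF lb(2) power_mono[OF d]]) (use lb(3) M(1) in simp)
      ultimately show ?thesis by (simp add: F heis_gap_eq)
    qed simp
    then show ?thesis using r0(1) M(1) by (intro exI[of _ "r0 / M"]) auto
  qed
  \<comment> \<open>The area term of \<open>heis_gap\<close> differs from the trapezoidal rule \<open>(b - a) (g a + g b) / 2\<close> only by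
    half the increment of \<open>w g w\<close>, so \<open>\<Phi>\<close> is a primitive of \<open>2 g\<close>.\<close>
  define \<Phi> where "\<Phi> w = w * g w - 2 * Z w" for w
  have "(\<Phi> has_field_derivative 2 * g a) (at a)" for a
  proof -
    obtain r0 where r0: "r0 > 0" "\<And>b. norm (b - a) < r0 \<Longrightarrow> norm (g b - g a) \<le> C * norm (b - a)"
      "\<And>b. norm (b - a) < r0 \<Longrightarrow> norm (Z b - Z a - (a * g b - g a * b) / 2) \<le> (C * norm (b - a))\<^sup>2"
      using loc[of a] by blast
    show ?thesis
    proof (rule DERIV_of_quadratic_error[OF r0(1)])
      fix b assume b: "norm (b - a) < r0"
      \<comment> \<open>Both summands are quadratic in \<open>b - a\<close>: the first by the local
        Lipschitz bound for \<open>g\<close>, the second by the gap estimate.\<close>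
      have "\<Phi> b - \<Phi> a - (b - a) * (2 * g a) =
          (b - a) * (g b - g a) - 2 * (Z b - Z a - (a * g b - g a * b) / 2)"
        by (simp add: \<Phi>_def field_simps)
      also have "norm \<dots> \<le> norm (b - a) * norm (g b - g a) + 2 * norm (Z b - Z a - (a * g b - g a * b) / 2)"
        by (rule order_trans[OF norm_triangle_ineq4]) (simp only: norm_mult norm_numeral order_refl)
      also have "\<dots> \<le> norm (b - a) * (C * norm (b - a)) + 2 * (C * norm (b - a))\<^sup>2"
        by (intro add_mono mult_left_mono r0(2,3) b) auto
      also have "\<dots> = (C + 2 * C\<^sup>2) * (norm (b - a))\<^sup>2" by (simp add: power2_eq_square algebra_simps)
      finally show "norm (\<Phi> b - \<Phi> a - (b - a) * (2 * g a)) \<le> (C + 2 * C\<^sup>2) * (norm (b - a))\<^sup>2" .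
    qed
  qed
  \<comment> \<open>A complex derivative of an entire function is itself entire, so \<open>g\<close>
    gains holomorphy from its primitive.\<close>
  then have "(\<lambda>w. 2 * g w) holomorphic_on UNIV"
    by (rule derivative_is_holomorphic[OF open_UNIV])
  from holomorphic_on_mult[OF holomorphic_on_const[of "1/2"] this]
  have "g holomorphic_on UNIV" by simp
  then show ?thesis using entire_affine loc by blast
qed

end
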